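(* If the triangle inequality holds for the design costs $\overline{c}$, then for all $\chi=\mathbb{1}_{\{Q=Q'\}}$ with $Q'\in\mathcal{X}_{\theta,\rho}$ (i.e. $\chi_{Q'}=1$ and $\chi_Q=0$ for $Q\ne Q'$), the cover formulation (R) of the stochastic TSP with generalized latency (STSP-GL) decomposes into the problem TSP-GL$(Q')$. Furthermore, $(\mathbb{1}_{\{Q=Q^*\}},\hat x(Q^* ),\hat f(Q^* ))$, with $Q^*=\arg\min\{\mathrm{obj}_{\mathrm{TSP\text{-}GL}}(Q) : Q\in\mathcal{X}_{\theta,\rho}\}$, is an optimal solution $(\chi,x,f)$ of (R).
   Context: Setting. $G=(N,E\cup A)$ is a complete mixed graph with node set $N=\{1,\dots,n\}$, edge set $E=\{[i,j] : i,j\in N,\ i<j\}$ (vehicle movement) and arc set $A=\{(i,j): i,j\in N,\ i\ne j\}$ (passenger movement); the edge $[i,j]$ corresponds to the arcs $(i,j)$ and $(j,i)$. $\mathcal{C}\subseteq N$ is the set of compulsory stops. Each edge $[i,j]\in E$ has a design cost $\overline{c}_{[i,j]}>0$ and each arc $(i,j)\in A$ a travel time $c_{ij}$. The triangle inequality for $\overline{c}$ means $\overline{c}_{[i,j]}\le\overline{c}_{[i,k]}+\overline{c}_{[k,j]}$ for all distinct $i,j,k\in N$ (edges taken unordered). For each origin-destination node pair $(h,k)$ the demand $d^{hk}(\xi)\ge 0$ is a discrete random variable, and $D=\{(h,k): h,k\in N,\ P(d^{hk}(\xi)>0)>0\}$ is the set of origin-destination node pairs with positive probability of non-zero demand. Standing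 assumption: instances are such that $D$ does not induce more than one connected component (so no subtour elimination constraints are used). $S$ is a finite set of equally likely scenarios; scenario $s\in S$ specifies passenger demands $s^{hk}$, $(h,k)\in D$. $\theta\in[0,1]$ is the service level, $1-\rho\in[0,1]$ is the feasibility frequency, and $\alpha$ is a tradeoff parameter between design and routing costs. Passenger routing costs are $$\tilde q_{ij}^{hk} = c_{ij}\Big(\frac{1}{|S|}\sum_{s\in S}\frac{s^{hk}}{\theta\sum_{(u,v)\in D}s^{uv}}\Big),\qquad (i,j)\in A,\ (h,k)\in D,$$ where the denominators are taken to be nonzero. Feasibility cover: a set $Q\subseteq D$ such that there exists a vector $\gamma\in\{0,1\}^{|S|}$ with $\sum_{(h,k)\in Q}s^{hk}\ge\theta\gamma_s\sum_{(h,k)\in D}s^{hk}$ for all $s\in S$ and $\sum_{s\in S}\gamma_s\ge(1-\rho)|S|$. It is minimal if no proper subset of it is a feasibility cover. $\mathcal{X}_{\theta,\rho}$ denotes the set of all minimal feasibility covers of $D$. For $Q\in\mathcal{X}_{\theta,\rho}$: $l_Q(i)=1$ if $i\in\mathcal{C}$ or there exists $(h,k)\in Q$ with $i=h$ or $i=k$, and $l_Q(i)=0$ otherwise; $r_Q^{hk}=1$ if $(h,k)\in Q$ and $r_Q^{hk}=0$ otherwise. Problem (R), with variables $\chi_Q$ ($Q\in\mathcal{X}_{\theta,\rho}$), $x_{[i,j]}$ ($[i,j]\in E$), $f_{ij}^{hk}$ ($(i,j)\in A$, $(h,k)\in D$): $$\min\ (1-\alpha)\sum_{[i,j]\in E}\overline{c}_{[i,j]}x_{[i,j]}+\alpha\sum_{(i,j)\in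 A}\sum_{(h,k)\in D}\tilde q_{ij}^{hk}f_{ij}^{hk}$$ subject to - $\sum_{Q\in\mathcal{X}_{\theta,\rho}}\chi_Q=1$; - $\sum_{e\in E,\ e\text{ incident to }i}x_e-2\sum_{Q\in\mathcal{X}_{\theta,\rho}}\chi_Q l_Q(i)=0$ for all $i\in N$; - for all $i\in N$, $(h,k)\in D$: $\sum_{j:(i,j)\in A}f_{ij}^{hk}-\sum_{j':(j',i)\in A}f_{j'i}^{hk}$ equals $\sum_{Q\in\mathcal{X}_{\theta,\rho}}\chi_Q r_Q^{hk}$ if $i=h$, $-\sum_{Q\in\mathcal{X}_{\theta,\rho}}\chi_Q r_Q^{hk}$ if $i=k$, and $0$ otherwise; - $f_{ij}^{hk}\ge0$ for all $(i,j)\in A$, $(h,k)\in D$; - $x_{[i,j]}-f_{ij}^{hk}\ge0$ and $x_{[i,j]}-f_{ji}^{hk}\ge0$ for all $[i,j]\in E$, $(h,k)\in D$; - $x_{[i,j]}\in\{0,1\}$ for all $[i,j]\in E$ and $\chi_Q\in\{0,1\}$ for all $Q\in\mathcal{X}_{\theta,\rho}$. For a feasibility cover $Q$, let $N'(Q)=\{i : (i,j)\in Q\text{ or }(j',i)\in Q \text{ for some } j,j'\}$ (the nodes that are an origin or destination of a request in $Q$), $E'(Q)=\{[i,j] : [i,j]\in E,\ i,j\in N'(Q)\}$ and $A'(Q)=\{(i,j) : (i,j)\in A,\ i,j\in N'(Q)\}$. Problem TSP-GL$(Q)$, with variables $\bar x_{[i,j]}$ ($[i,j]\in E'(Q)$)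 and $\bar f_{ij}^{hk}$ ($(i,j)\in A'(Q)$, $(h,k)\in Q$): $$\min\ (1-\alpha)\sum_{[i,j]\in E'(Q)}\overline{c}_{[i,j]}\bar x_{[i,j]}+\alpha\sum_{(i,j)\in A'(Q)}\sum_{(h,k)\in Q}\tilde q_{ij}^{hk}\bar f_{ij}^{hk}$$ subject to - for all $i\in N'(Q)$, $(h,k)\in Q$: $\sum_{j:(i,j)\in A'(Q)}\bar f_{ij}^{hk}-\sum_{j':(j',i)\in A'(Q)}\bar f_{j'i}^{hk}$ equals $1$ if $i=h$, $-1$ if $i=k$, and $0$ if $i\ne h,k$; - $\sum_{e\in E'(Q),\ e\text{ incident to }i}\bar x_e=2$ for all $i\in N'(Q)$; - $\bar f_{ij}^{hk}\ge0$ for all $(i,j)\in A'(Q)$, $(h,k)\in Q$; - $\bar x_{[i,j]}-\bar f_{ij}^{hk}\ge0$ and $\bar x_{[i,j]}-\bar f_{ji}^{hk}\ge0$ for all $[i,j]\in E'(Q)$, $(h,k)\in Q$; - $\bar x_{[i,j]}\in\{0,1\}$ for all $[i,j]\in E'(Q)$. $\mathrm{obj}_{\mathrm{TSP\text{-}GL}}(Q)$ is the optimal objective value of TSP-GL$(Q)$. "(R) decomposes into TSP-GL$(Q')$" for $\chi=\mathbb{1}_{\{Q=Q'\}}$ means: in (R) with this $\chi$, the variables $x_{[i,j]}$ with $[i,j]\in E\setminus E'(Q')$ and $f_{ij}^{hk}$ with $(i,j)\notin A'(Q')$ or $(h,k)\notin Q'$ can be fixed to zero, and the problem in the remaining variables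 then coincides (objective and constraints) with TSP-GL$(Q')$. For a solution $(\bar x,\bar f)$ of TSP-GL$(Q)$ with $Q\in\mathcal{X}_{\theta,\rho}$, define $\hat x_{[i,j]}(Q)=\bar x_{[i,j]}$ if $[i,j]\in E'(Q)$ and $0$ otherwise, for all $[i,j]\in E$; and $\hat f_{ij}^{hk}(Q)=\bar f_{ij}^{hk}$ if $(i,j)\in A'(Q)$ and $(h,k)\in Q$, and $0$ otherwise, for all $(i,j)\in A$ and $(h,k)\in D$. In the claim, $\hat x(Q^* ),\hat f(Q^* )$ are formed from an optimal solution of TSP-GL$(Q^* )$.
   Formalization: Added: compulsory stops C lie in N'(Q') for the decomposition, and in N'(Q) for every minimal cover Q for optimality; otherwise (R) needs degree 2 at a stop TSP-GL omits. Travel times and scenario demands are taken nonnegative and α in [0,1]. *)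

theory Defs
  imports "HOL-Probability.Probability"
begin

text \<open>
  Nodes are natural numbers. The undirected edge \<open>[i,j]\<close> is the two-element set \<open>{i, j}\<close>, so
  incidence is membership; arcs and origin-destination pairs are ordered pairs. Vectors indexed by
  a finite set are total functions whose values off the index set are never looked at.
\<close>

type_synonym edge = "nat set"
type_synonym arc = "nat \<times> nat"
type_synonym request = "nat \<times> nat"

record ('w, 's) stsp_gl =
  node_count :: nat
  compulsory :: "nat set"                        \<comment> \<open>\<open>\<C>\<close>\<close>
  design_cost :: "edge \<Rightarrow> real"                  \<comment> \<open>\<open>c\<close> with overline\<close>
  travel_time :: "arc \<Rightarrow> real"
  prob_model :: "'w measure"                     \<comment> \<open>law of \<open>\<xi>\<close>\<close>
  demand :: "request \<Rightarrow> 'w \<Rightarrow> real"              \<comment> \<open>\<open>d\<^sup>h\<^sup>k(\<xi>)\<close>\<close>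
  scenarios :: "'s set"
  scen_demand :: "'s \<Rightarrow> request \<Rightarrow> real"         \<comment> \<open>\<open>s\<^sup>h\<^sup>k\<close>\<close>
  service_level :: real                          \<comment> \<open>\<open>\<theta>\<close>\<close>
  infeas_freq :: real                            \<comment> \<open>\<open>\<rho>\<close>; the feasibility frequency is \<open>1 - \<rho>\<close>\<close>
  tradeoff :: real                               \<comment> \<open>\<open>\<alpha>\<close>\<close>

definition nodes :: "('w, 's) stsp_gl \<Rightarrow> nat set" where
  "nodes I = {1..node_count I}"

definition edges :: "('w, 's) stsp_gl \<Rightarrow> edge set" where
  "edges I = {{i, j} | i j. i \<in> nodes I \<and> j \<in> nodes I \<and> i < j}"

definition arcs :: "('w, 's) stsp_gl \<Rightarrow> arc set" where
  "arcs I = {(i, j). i \<in> nodes I \<and> j \<in> nodes I \<and> i \<noteq> j}"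

definition requests :: "('w, 's) stsp_gl \<Rightarrow> request set" where  \<comment> \<open>\<open>D\<close>\<close>
  "requests I = {(h, k). h \<in> nodes I \<and> k \<in> nodes I \<and>
     measure (prob_model I) {w \<in> space (prob_model I). demand I (h, k) w > 0} > 0}"

definition request_nodes :: "request set \<Rightarrow> nat set" where  \<comment> \<open>\<open>N'(Q)\<close>\<close>
  "request_nodes Q = {i. (\<exists>j. (i, j) \<in> Q) \<or> (\<exists>j'. (j', i) \<in> Q)}"

definition request_edges :: "('w, 's) stsp_gl \<Rightarrow> request set \<Rightarrow> edge set" where
  "request_edges I Q = {{i, j} | i j. {i, j} \<in> edges I \<and> i \<in> request_nodes Q \<and> j \<in> request_nodes Q}"

definition request_arcs :: "('w, 's) stsp_gl \<Rightarrow> request set \<Rightarrow> arc set" where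
  "request_arcs I Q = {(i, j) \<in> arcs I. i \<in> request_nodes Q \<and> j \<in> request_nodes Q}"

text \<open>At most one connected component in the graph on the end points of the requests in \<open>Q\<close>
  whose edges are those requests, directions ignored.\<close>

definition induces_one_component :: "request set \<Rightarrow> bool" where
  "induces_one_component Q \<longleftrightarrow>
     (\<forall>u \<in> request_nodes Q. \<forall>v \<in> request_nodes Q. (u, v) \<in> (Q \<union> Q\<inverse>)\<^sup>*)"

text \<open>Travel times and scenario demands (realisations of nonnegative demands) are nonnegative.
  Pairs \<open>(h, h)\<close> need not be excluded: a flow problem that has to serve one is infeasible.\<close>

definition stsp_gl_instance :: "('w, 's) stsp_gl \<Rightarrow> bool" where
  "stsp_gl_instance I \<longleftrightarrow>
     compulsory I \<subseteq> nodes I \<and>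
     (\<forall>e \<in> edges I. design_cost I e > 0) \<and>
     (\<forall>a \<in> arcs I. travel_time I a \<ge> 0) \<and>
     prob_space (prob_model I) \<and>
     (\<forall>h \<in> nodes I. \<forall>k \<in> nodes I.
        demand I (h, k) \<in> borel_measurable (prob_model I) \<and>
        countable (demand I (h, k) ` space (prob_model I)) \<and>
        (\<forall>w \<in> space (prob_model I). demand I (h, k) w \<ge> 0)) \<and>
     induces_one_component (requests I) \<and>
     finite (scenarios I) \<and> scenarios I \<noteq> {} \<and>
     (\<forall>s \<in> scenarios I. \<forall>q \<in> requests I. scen_demand I s q \<ge> 0) \<and>
     0 \<le> service_level I \<and> service_level I \<le> 1 \<and>
     0 \<le> 1 - infeas_freq I \<and> 1 - infeas_freq I \<le> 1 \<and>
     0 \<le> tradeoff I \<and> tradeoff I \<le> 1 \<and>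
     (\<forall>s \<in> scenarios I. service_level I * (\<Sum>q \<in> requests I. scen_demand I s q) \<noteq> 0)"

definition triangle_inequality :: "('w, 's) stsp_gl \<Rightarrow> bool" where
  "triangle_inequality I \<longleftrightarrow>
     (\<forall>i \<in> nodes I. \<forall>j \<in> nodes I. \<forall>k \<in> nodes I. i \<noteq> j \<and> i \<noteq> k \<and> j \<noteq> k \<longrightarrow>
        design_cost I {i, j} \<le> design_cost I {i, k} + design_cost I {k, j})"

definition routing_cost :: "('w, 's) stsp_gl \<Rightarrow> arc \<Rightarrow> request \<Rightarrow> real" where  \<comment> \<open>\<open>q\<close> with tilde\<close>
  "routing_cost I a r = travel_time I a *
     (1 / real (card (scenarios I)) *
      (\<Sum>s \<in> scenarios I. scen_demand I s r /
         (service_level I * (\<Sum>q \<in> requests I. scen_demand I s q))))"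

definition feasibility_cover :: "('w, 's) stsp_gl \<Rightarrow> request set \<Rightarrow> bool" where
  "feasibility_cover I Q \<longleftrightarrow> Q \<subseteq> requests I \<and>
     (\<exists>\<gamma> :: 's \<Rightarrow> real.
        (\<forall>s \<in> scenarios I. \<gamma> s \<in> {0, 1}) \<and>
        (\<forall>s \<in> scenarios I. (\<Sum>q \<in> Q. scen_demand I s q)
            \<ge> service_level I * \<gamma> s * (\<Sum>q \<in> requests I. scen_demand I s q)) \<and>
        (\<Sum>s \<in> scenarios I. \<gamma> s) \<ge> (1 - infeas_freq I) * real (card (scenarios I)))"

definition minimal_covers :: "('w, 's) stsp_gl \<Rightarrow> request set set" where
  "minimal_covers I = {Q. feasibility_cover I Q \<and> (\<forall>Q'. Q' \<subset> Q \<longrightarrow> \<not> feasibility_cover I Q')}"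

definition stop_ind :: "('w, 's) stsp_gl \<Rightarrow> request set \<Rightarrow> nat \<Rightarrow> real" where  \<comment> \<open>\<open>l\<^sub>Q(i)\<close>\<close>
  "stop_ind I Q i = (if i \<in> compulsory I \<or> (\<exists>(h, k) \<in> Q. i = h \<or> i = k) then 1 else 0)"

definition request_ind :: "request set \<Rightarrow> request \<Rightarrow> real" where  \<comment> \<open>\<open>r\<^sub>Q\<^sup>h\<^sup>k\<close>\<close>
  "request_ind Q q = (if q \<in> Q then 1 else 0)"

definition R_objective ::
  "('w, 's) stsp_gl \<Rightarrow> (edge \<Rightarrow> real) \<Rightarrow> (arc \<Rightarrow> request \<Rightarrow> real) \<Rightarrow> real" where
  "R_objective I x f =
     (1 - tradeoff I) * (\<Sum>e \<in> edges I. design_cost I e * x e) +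
     tradeoff I * (\<Sum>a \<in> arcs I. \<Sum>q \<in> requests I. routing_cost I a q * f a q)"

definition R_feasible ::
  "('w, 's) stsp_gl \<Rightarrow> (request set \<Rightarrow> real) \<Rightarrow> (edge \<Rightarrow> real) \<Rightarrow> (arc \<Rightarrow> request \<Rightarrow> real) \<Rightarrow> bool" where
  "R_feasible I chi x f \<longleftrightarrow>
     (\<Sum>Q \<in> minimal_covers I. chi Q) = 1 \<and>
     (\<forall>i \<in> nodes I. (\<Sum>e \<in> {e \<in> edges I. i \<in> e}. x e)
        - 2 * (\<Sum>Q \<in> minimal_covers I. chi Q * stop_ind I Q i) = 0) \<and>
     (\<forall>i \<in> nodes I. \<forall>(h, k) \<in> requests I.
        (\<Sum>j \<in> {j. (i, j) \<in> arcs I}. f (i, j) (h, k)) - (\<Sum>j' \<in> {j'. (j', i) \<in> arcs I}. f (j', i) (h, k)) =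
        (if i = h then (\<Sum>Q \<in> minimal_covers I. chi Q * request_ind Q (h, k))
         else if i = k then - (\<Sum>Q \<in> minimal_covers I. chi Q * request_ind Q (h, k))
         else 0)) \<and>
     (\<forall>a \<in> arcs I. \<forall>q \<in> requests I. f a q \<ge> 0) \<and>
     (\<forall>i j. {i, j} \<in> edges I \<longrightarrow>
        (\<forall>q \<in> requests I. x {i, j} - f (i, j) q \<ge> 0 \<and> x {i, j} - f (j, i) q \<ge> 0)) \<and>
     (\<forall>e \<in> edges I. x e \<in> {0, 1}) \<and>
     (\<forall>Q \<in> minimal_covers I. chi Q \<in> {0, 1})"

definition R_optimal ::
  "('w, 's) stsp_gl \<Rightarrow> (request set \<Rightarrow> real) \<Rightarrow> (edge \<Rightarrow> real) \<Rightarrow> (arc \<Rightarrow> request \<Rightarrow> real) \<Rightarrow> bool" where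
  "R_optimal I chi x f \<longleftrightarrow> R_feasible I chi x f \<and>
     (\<forall>chi' x' f'. R_feasible I chi' x' f' \<longrightarrow> R_objective I x f \<le> R_objective I x' f')"

definition TSPGL_objective ::
  "('w, 's) stsp_gl \<Rightarrow> request set \<Rightarrow> (edge \<Rightarrow> real) \<Rightarrow> (arc \<Rightarrow> request \<Rightarrow> real) \<Rightarrow> real" where
  "TSPGL_objective I Q x f =
     (1 - tradeoff I) * (\<Sum>e \<in> request_edges I Q. design_cost I e * x e) +
     tradeoff I * (\<Sum>a \<in> request_arcs I Q. \<Sum>q \<in> Q. routing_cost I a q * f a q)"

definition TSPGL_feasible ::
  "('w, 's) stsp_gl \<Rightarrow> request set \<Rightarrow> (edge \<Rightarrow> real) \<Rightarrow> (arc \<Rightarrow> request \<Rightarrow> real) \<Rightarrow> bool" where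
  "TSPGL_feasible I Q x f \<longleftrightarrow>
     (\<forall>i \<in> request_nodes Q. \<forall>(h, k) \<in> Q.
        (\<Sum>j \<in> {j. (i, j) \<in> request_arcs I Q}. f (i, j) (h, k))
        - (\<Sum>j' \<in> {j'. (j', i) \<in> request_arcs I Q}. f (j', i) (h, k)) =
        (if i = h then 1 else if i = k then - 1 else 0)) \<and>
     (\<forall>i \<in> request_nodes Q. (\<Sum>e \<in> {e \<in> request_edges I Q. i \<in> e}. x e) = 2) \<and>
     (\<forall>a \<in> request_arcs I Q. \<forall>q \<in> Q. f a q \<ge> 0) \<and>
     (\<forall>i j. {i, j} \<in> request_edges I Q \<longrightarrow>
        (\<forall>q \<in> Q. x {i, j} - f (i, j) q \<ge> 0 \<and> x {i, j} - f (j, i) q \<ge> 0)) \<and>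
     (\<forall>e \<in> request_edges I Q. x e \<in> {0, 1})"

definition TSPGL_optimal ::
  "('w, 's) stsp_gl \<Rightarrow> request set \<Rightarrow> (edge \<Rightarrow> real) \<Rightarrow> (arc \<Rightarrow> request \<Rightarrow> real) \<Rightarrow> bool" where
  "TSPGL_optimal I Q x f \<longleftrightarrow> TSPGL_feasible I Q x f \<and>
     (\<forall>x' f'. TSPGL_feasible I Q x' f' \<longrightarrow> TSPGL_objective I Q x f \<le> TSPGL_objective I Q x' f')"

text \<open>The optimal value is extended real so that it is \<open>\<infinity>\<close> for an infeasible problem (for example
  when exactly two nodes have to be visited).\<close>

definition obj_TSPGL :: "('w, 's) stsp_gl \<Rightarrow> request set \<Rightarrow> ereal" where
  "obj_TSPGL I Q = Inf {ereal (TSPGL_objective I Q x f) | x f. TSPGL_feasible I Q x f}"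

definition choose_cover :: "request set \<Rightarrow> request set \<Rightarrow> real" where
  "choose_cover Q' = (\<lambda>Q. if Q = Q' then 1 else 0)"

definition extend_x ::
  "('w, 's) stsp_gl \<Rightarrow> request set \<Rightarrow> (edge \<Rightarrow> real) \<Rightarrow> edge \<Rightarrow> real" where
  "extend_x I Q x = (\<lambda>e. if e \<in> request_edges I Q then x e else 0)"

definition extend_f ::
  "('w, 's) stsp_gl \<Rightarrow> request set \<Rightarrow> (arc \<Rightarrow> request \<Rightarrow> real) \<Rightarrow> arc \<Rightarrow> request \<Rightarrow> real" where
  "extend_f I Q f = (\<lambda>a q. if a \<in> request_arcs I Q \<and> q \<in> Q then f a q else 0)"

definition vanishes_outside ::
  "('w, 's) stsp_gl \<Rightarrow> request set \<Rightarrow> (edge \<Rightarrow> real) \<Rightarrow> (arc \<Rightarrow> request \<Rightarrow> real) \<Rightarrow> bool" where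
  "vanishes_outside I Q x f \<longleftrightarrow>
     (\<forall>e \<in> edges I - request_edges I Q. x e = 0) \<and>
     (\<forall>a \<in> arcs I. \<forall>q \<in> requests I. a \<notin> request_arcs I Q \<or> q \<notin> Q \<longrightarrow> f a q = 0)"

text \<open>The first conjunct says that, with \<open>\<chi>\<close> fixed to the indicator of \<open>Q\<close>, the remaining variables
  outside TSP-GL(\<open>Q\<close>) can be fixed to zero without loss of optimality. In the second, a point of
  the problem so reduced is the extension by zero of a vector of TSP-GL(\<open>Q\<close>) variables.\<close>

definition R_decomposes :: "('w, 's) stsp_gl \<Rightarrow> request set \<Rightarrow> bool" where
  "R_decomposes I Q \<longleftrightarrow>
     (\<forall>x f. R_feasible I (choose_cover Q) x f \<longrightarrow>
        (\<exists>x' f'. R_feasible I (choose_cover Q) x' f' \<and> vanishes_outside I Q x' f' \<and>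
           R_objective I x' f' \<le> R_objective I x f)) \<and>
     (\<forall>x f. (R_feasible I (choose_cover Q) (extend_x I Q x) (extend_f I Q f) \<longleftrightarrow>
               TSPGL_feasible I Q x f) \<and>
            R_objective I (extend_x I Q x) (extend_f I Q f) = TSPGL_objective I Q x f)"

end

theory Submission
  imports Defs
begin

text \<open>
  Fix \<open>\<chi>\<close> to the indicator of a minimal cover \<open>Q\<close> whose end points include all compulsory stops. The
  degree constraint of (R) then reads \<open>2\<close> at the nodes of \<open>N'(Q)\<close> and \<open>0\<close> at every other node. As the
  edge variables are nonnegative, degree \<open>0\<close> switches off every edge that leaves \<open>N'(Q)\<close>, and the
  coupling \<open>0 \<le> f \<le> x\<close> switches off the flow on the corresponding arcs
  (\<open>R_feasible_off_cover\<close>). What is left outside TSP-GL(\<open>Q\<close>) is flow for requests not in \<open>Q\<close>. Such a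
  request has right-hand side \<open>0\<close>, so its flow is a circulation; deleting it keeps feasibility, and
  cannot raise the objective because routing costs are nonnegative (\<open>R_feasible_extend\<close>,
  \<open>R_objective_extend_le\<close>). On vectors extended by zero, the constraints and the objective of (R) are
  those of TSP-GL(\<open>Q\<close>) (\<open>R_feasible_extend_iff\<close>, \<open>R_objective_extend\<close>). This is the decomposition.

  For the second claim, integrality and \<open>\<Sum> \<chi> = 1\<close> force every feasible \<open>\<chi>\<close> to be the indicator of one
  minimal cover \<open>Q\<close> (\<open>R_feasible_obtains_cover\<close>). Hence the value of any feasible point of (R) is at
  least the optimal value of TSP-GL(\<open>Q\<close>) for some \<open>Q\<close>, and so at least the smallest of these values,
  which the extension of an optimal solution of TSP-GL(\<open>Q\<^sup>*\<close>) attains.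
\<close>

section \<open>Edges, arcs and requests\<close>

lemma finite_nodes: "finite (nodes I)"
  by (simp add: nodes_def)

lemma doubleton_in_edges_iff:
  "{i, j} \<in> edges I \<longleftrightarrow> i \<in> nodes I \<and> j \<in> nodes I \<and> i \<noteq> j"
proof
  assume "{i, j} \<in> edges I"
  then show "i \<in> nodes I \<and> j \<in> nodes I \<and> i \<noteq> j"
    by (auto simp: edges_def doubleton_eq_iff)
next
  assume "i \<in> nodes I \<and> j \<in> nodes I \<and> i \<noteq> j"
  then show "{i, j} \<in> edges I"
    unfolding edges_def by (cases i j rule: linorder_cases) (auto simp: insert_commute)
qed

lemma doubleton_in_request_edges_iff:
  "{i, j} \<in> request_edges I Q \<longleftrightarrow>
     {i, j} \<in> edges I \<and> i \<in> request_nodes Q \<and> j \<in> request_nodes Q"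
  by (auto simp: request_edges_def doubleton_eq_iff insert_commute)

lemma pair_in_arcs_iff: "(i, j) \<in> arcs I \<longleftrightarrow> {i, j} \<in> edges I"
  by (auto simp: arcs_def doubleton_in_edges_iff)

lemma pair_in_request_arcs_iff: "(i, j) \<in> request_arcs I Q \<longleftrightarrow> {i, j} \<in> request_edges I Q"
  by (simp add: request_arcs_def doubleton_in_request_edges_iff pair_in_arcs_iff)

lemma edgeE:
  assumes "e \<in> edges I"
  obtains i j where "e = {i, j}"
  using assms by (auto simp: edges_def)

lemma finite_edges: "finite (edges I)"
  by (rule finite_subset[of _ "Pow (nodes I)"]) (auto simp: edges_def finite_nodes)

lemma finite_arcs: "finite (arcs I)"
  by (rule finite_subset[of _ "nodes I \<times> nodes I"]) (auto simp: arcs_def finite_nodes)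

lemma finite_out_neighbours: "finite {j. (i, j) \<in> arcs I}"
  by (rule finite_subset[OF _ finite_nodes[of I]]) (auto simp: arcs_def)

lemma finite_in_neighbours: "finite {j. (j, i) \<in> arcs I}"
  by (rule finite_subset[OF _ finite_nodes[of I]]) (auto simp: arcs_def)

lemma finite_requests: "finite (requests I)"
  by (rule finite_subset[of _ "nodes I \<times> nodes I"]) (auto simp: requests_def finite_nodes)

lemma request_edges_subset: "request_edges I Q \<subseteq> edges I"
  by (auto simp: request_edges_def)

lemma request_arcs_subset: "request_arcs I Q \<subseteq> arcs I"
  by (auto simp: request_arcs_def)

lemma request_nodes_subset: "Q \<subseteq> requests I \<Longrightarrow> request_nodes Q \<subseteq> nodes I"
  by (auto simp: request_nodes_def requests_def)

lemma minimal_cover_subset_requests: "Q \<in> minimal_covers I \<Longrightarrow> Q \<subseteq> requests I"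
  by (simp add: minimal_covers_def feasibility_cover_def)

lemma finite_minimal_covers: "finite (minimal_covers I)"
  by (rule finite_subset[of _ "Pow (requests I)"])
     (auto dest: minimal_cover_subset_requests simp: finite_requests)

lemma routing_cost_nonneg:
  assumes "stsp_gl_instance I" "a \<in> arcs I" "q \<in> requests I"
  shows "routing_cost I a q \<ge> 0"
  using assms unfolding stsp_gl_instance_def routing_cost_def
  by (intro mult_nonneg_nonneg sum_nonneg divide_nonneg_nonneg) auto

section \<open>The problem (R) for a fixed cover\<close>

lemma sum_choose_cover:
  assumes "Q \<in> minimal_covers I"
  shows "(\<Sum>Q' \<in> minimal_covers I. choose_cover Q Q' * g Q') = g Q"
proof -
  have "(\<Sum>Q' \<in> minimal_covers I. choose_cover Q Q' * g Q')
      = (\<Sum>Q' \<in> minimal_covers I. if Q' = Q then g Q' else 0)"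
    by (intro sum.cong) (auto simp: choose_cover_def)
  then show ?thesis
    using assms by (simp add: finite_minimal_covers)
qed

text \<open>Once all compulsory stops are end points of the cover, visiting a node and being an end point
  are the same condition; a compulsory stop outside \<open>N'(Q)\<close> would have to be visited in (R) but does
  not occur in TSP-GL(\<open>Q\<close>).\<close>

lemma stop_ind_eq_request_node:
  assumes "compulsory I \<subseteq> request_nodes Q"
  shows "stop_ind I Q i = (if i \<in> request_nodes Q then 1 else 0)"
  using assms by (auto simp: stop_ind_def request_nodes_def)

lemma R_feasible_choose_cover_iff:
  assumes Q: "Q \<in> minimal_covers I" and compulsory: "compulsory I \<subseteq> request_nodes Q"
  shows "R_feasible I (choose_cover Q) x f \<longleftrightarrow>
     (\<forall>i \<in> nodes I. (\<Sum>e \<in> {e \<in> edges I. i \<in> e}. x e) = (if i \<in> request_nodes Q then 2 else 0)) \<and>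
     (\<forall>i \<in> nodes I. \<forall>(h, k) \<in> requests I.
        (\<Sum>j \<in> {j. (i, j) \<in> arcs I}. f (i, j) (h, k)) - (\<Sum>j' \<in> {j'. (j', i) \<in> arcs I}. f (j', i) (h, k)) =
        (if i = h then request_ind Q (h, k) else if i = k then - request_ind Q (h, k) else 0)) \<and>
     (\<forall>a \<in> arcs I. \<forall>q \<in> requests I. f a q \<ge> 0) \<and>
     (\<forall>i j. {i, j} \<in> edges I \<longrightarrow>
        (\<forall>q \<in> requests I. x {i, j} - f (i, j) q \<ge> 0 \<and> x {i, j} - f (j, i) q \<ge> 0)) \<and>
     (\<forall>e \<in> edges I. x e \<in> {0, 1})"
proof -
  have one: "(\<Sum>Q' \<in> minimal_covers I. choose_cover Q Q') = 1"
    using sum_choose_cover[OF Q, of "\<lambda>_. 1"] by simp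
  have binary: "\<forall>Q' \<in> minimal_covers I. choose_cover Q Q' \<in> {0, 1}"
    by (simp add: choose_cover_def)
  have degree: "s - 2 * (if b then 1 else 0) = 0 \<longleftrightarrow> s = (if b then 2 else 0)" for s :: real and b
    by auto
  show ?thesis
    unfolding R_feasible_def sum_choose_cover[OF Q] stop_ind_eq_request_node[OF compulsory] degree
    using one binary by simp
qed

text \<open>A node outside \<open>N'(Q)\<close> has degree \<open>0\<close>, so its incident edges carry neither the vehicle nor,
  through the coupling constraints, any passengers.\<close>

lemma R_feasible_off_cover:
  assumes Q: "Q \<in> minimal_covers I" and compulsory: "compulsory I \<subseteq> request_nodes Q"
    and feas: "R_feasible I (choose_cover Q) x f"
  shows "\<And>e. e \<in> edges I \<Longrightarrow> e \<notin> request_edges I Q \<Longrightarrow> x e = 0"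
    and "\<And>a q. a \<in> arcs I \<Longrightarrow> a \<notin> request_arcs I Q \<Longrightarrow> q \<in> requests I \<Longrightarrow> f a q = 0"
proof -
  note R = feas[unfolded R_feasible_choose_cover_iff[OF Q compulsory]]
  have zero_incident: "x e = 0"
    if e: "e \<in> edges I" and v: "v \<in> e" "v \<in> nodes I" "v \<notin> request_nodes Q" for e v
  proof -
    have "(\<Sum>e \<in> {e \<in> edges I. v \<in> e}. x e) = 0"
      using R v by auto
    moreover have "\<forall>e \<in> {e \<in> edges I. v \<in> e}. x e \<ge> 0"
      using R by force
    ultimately have "\<forall>e \<in> {e \<in> edges I. v \<in> e}. x e = 0"
      using finite_edges[of I] by (subst (asm) sum_nonneg_eq_0_iff) auto
    then show ?thesis
      using e v by auto
  qed
  show x_zero: "x e = 0" if e: "e \<in> edges I" and off: "e \<notin> request_edges I Q" for e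
  proof -
    obtain i j where ij: "e = {i, j}"
      using e by (rule edgeE)
    then have "i \<in> nodes I" "j \<in> nodes I" "i \<notin> request_nodes Q \<or> j \<notin> request_nodes Q"
      using e off by (auto simp: doubleton_in_edges_iff doubleton_in_request_edges_iff)
    then show ?thesis
      using zero_incident[OF e] ij by auto
  qed
  show "f a q = 0" if a: "a \<in> arcs I" "a \<notin> request_arcs I Q" and q: "q \<in> requests I" for a q
  proof -
    obtain i j where ij: "a = (i, j)"
      by (cases a)
    then have e: "{i, j} \<in> edges I" "{i, j} \<notin> request_edges I Q"
      using a by (simp_all add: pair_in_arcs_iff pair_in_request_arcs_iff)
    then have "f (i, j) q \<le> x {i, j}"
      using R q by auto
    moreover have "f (i, j) q \<ge> 0"
      using R a q ij by auto
    ultimately show ?thesis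
      using x_zero[OF e] ij by simp
  qed
qed

section \<open>Extension by zero\<close>

lemma sum_extend_x_incident:
  "(\<Sum>e \<in> {e \<in> edges I. i \<in> e}. extend_x I Q x e) = (\<Sum>e \<in> {e \<in> request_edges I Q. i \<in> e}. x e)"
  using finite_edges[of I] request_edges_subset[of I Q]
  by (intro sum.mono_neutral_cong_right) (auto simp: extend_x_def)

lemma sum_extend_f_out:
  "(\<Sum>j \<in> {j. (i, j) \<in> arcs I}. extend_f I Q f (i, j) q) =
     (if q \<in> Q then \<Sum>j \<in> {j. (i, j) \<in> request_arcs I Q}. f (i, j) q else 0)"
proof (cases "q \<in> Q")
  case True
  then have "(\<Sum>j \<in> {j. (i, j) \<in> arcs I}. extend_f I Q f (i, j) q) =
      (\<Sum>j \<in> {j. (i, j) \<in> request_arcs I Q}. f (i, j) q)"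
    using finite_out_neighbours[of i I] request_arcs_subset[of I Q]
    by (intro sum.mono_neutral_cong_right) (auto simp: extend_f_def)
  with True show ?thesis by simp
qed (simp add: extend_f_def)

lemma sum_extend_f_in:
  "(\<Sum>j \<in> {j. (j, i) \<in> arcs I}. extend_f I Q f (j, i) q) =
     (if q \<in> Q then \<Sum>j \<in> {j. (j, i) \<in> request_arcs I Q}. f (j, i) q else 0)"
proof (cases "q \<in> Q")
  case True
  then have "(\<Sum>j \<in> {j. (j, i) \<in> arcs I}. extend_f I Q f (j, i) q) =
      (\<Sum>j \<in> {j. (j, i) \<in> request_arcs I Q}. f (j, i) q)"
    using finite_in_neighbours[of i I] request_arcs_subset[of I Q]
    by (intro sum.mono_neutral_cong_right) (auto simp: extend_f_def)
  with True show ?thesis by simp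
qed (simp add: extend_f_def)

lemma R_objective_extend:
  assumes "Q \<subseteq> requests I"
  shows "R_objective I (extend_x I Q x) (extend_f I Q f) = TSPGL_objective I Q x f"
proof -
  have "(\<Sum>e \<in> edges I. design_cost I e * extend_x I Q x e) =
      (\<Sum>e \<in> request_edges I Q. design_cost I e * x e)"
    using finite_edges[of I] request_edges_subset[of I Q]
    by (intro sum.mono_neutral_cong_right) (auto simp: extend_x_def)
  moreover have "(\<Sum>a \<in> arcs I. \<Sum>q \<in> requests I. routing_cost I a q * extend_f I Q f a q) =
      (\<Sum>a \<in> request_arcs I Q. \<Sum>q \<in> Q. routing_cost I a q * f a q)"
  proof (rule sum.mono_neutral_cong_right)
    fix a
    assume "a \<in> request_arcs I Q"
    then show "(\<Sum>q \<in> requests I. routing_cost I a q * extend_f I Q f a q) =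
        (\<Sum>q \<in> Q. routing_cost I a q * f a q)"
      using assms finite_requests[of I]
      by (intro sum.mono_neutral_cong_right) (auto simp: extend_f_def)
  qed (use finite_arcs[of I] request_arcs_subset[of I Q] in \<open>auto simp: extend_f_def\<close>)
  ultimately show ?thesis
    by (simp add: R_objective_def TSPGL_objective_def)
qed

text \<open>On vectors extended by zero, a constraint of (R) that is not one of TSP-GL(\<open>Q\<close>) holds anyway:
  all its variables are zero, or it is the coupling \<open>x \<ge> 0\<close> for a request not in \<open>Q\<close>, which
  integrality of \<open>x\<close> implies. The flow balance of a request in \<open>Q\<close> at a node outside \<open>N'(Q)\<close> reads
  \<open>0 = 0\<close>, because both end points of the request lie in \<open>N'(Q)\<close>.\<close>

lemma R_feasible_extend_iff:
  assumes Q: "Q \<in> minimal_covers I" and compulsory: "compulsory I \<subseteq> request_nodes Q"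
  shows "R_feasible I (choose_cover Q) (extend_x I Q x) (extend_f I Q f) \<longleftrightarrow> TSPGL_feasible I Q x f"
proof -
  have Q_sub: "Q \<subseteq> requests I"
    using Q by (rule minimal_cover_subset_requests)
  have N_sub: "request_nodes Q \<subseteq> nodes I"
    using Q_sub by (rule request_nodes_subset)
  have ends: "h \<in> request_nodes Q" "k \<in> request_nodes Q" if "(h, k) \<in> Q" for h k
    using that by (auto simp: request_nodes_def)
  have no_edges: "{e \<in> request_edges I Q. i \<in> e} = {}" if "i \<notin> request_nodes Q" for i
    using that by (auto simp: request_edges_def)
  have no_arcs: "{j. (i, j) \<in> request_arcs I Q} = {}" "{j. (j, i) \<in> request_arcs I Q} = {}"
    if "i \<notin> request_nodes Q" for i
    using that by (auto simp: request_arcs_def)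
  have degree: "(\<forall>i \<in> nodes I. (\<Sum>e \<in> {e \<in> edges I. i \<in> e}. extend_x I Q x e) =
        (if i \<in> request_nodes Q then 2 else 0)) \<longleftrightarrow>
      (\<forall>i \<in> request_nodes Q. (\<Sum>e \<in> {e \<in> request_edges I Q. i \<in> e}. x e) = 2)"
    unfolding sum_extend_x_incident using N_sub by (auto simp: no_edges)
  have balance: "(\<forall>i \<in> nodes I. \<forall>(h, k) \<in> requests I.
        (\<Sum>j \<in> {j. (i, j) \<in> arcs I}. extend_f I Q f (i, j) (h, k))
        - (\<Sum>j' \<in> {j'. (j', i) \<in> arcs I}. extend_f I Q f (j', i) (h, k)) =
        (if i = h then request_ind Q (h, k) else if i = k then - request_ind Q (h, k) else 0)) \<longleftrightarrow>
      (\<forall>i \<in> request_nodes Q. \<forall>(h, k) \<in> Q.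
        (\<Sum>j \<in> {j. (i, j) \<in> request_arcs I Q}. f (i, j) (h, k))
        - (\<Sum>j' \<in> {j'. (j', i) \<in> request_arcs I Q}. f (j', i) (h, k)) =
        (if i = h then 1 else if i = k then - 1 else 0))"
    (is "?L \<longleftrightarrow> ?R")
  proof
    assume L: ?L
    show ?R
    proof safe
      fix i h k
      assume i: "i \<in> request_nodes Q" and hk: "(h, k) \<in> Q"
      then have "i \<in> nodes I" "(h, k) \<in> requests I"
        using N_sub Q_sub by auto
      from L[rule_format, OF this] hk
      show "(\<Sum>j \<in> {j. (i, j) \<in> request_arcs I Q}. f (i, j) (h, k))
          - (\<Sum>j' \<in> {j'. (j', i) \<in> request_arcs I Q}. f (j', i) (h, k)) =
          (if i = h then 1 else if i = k then - 1 else 0)"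
        by (simp add: sum_extend_f_out sum_extend_f_in request_ind_def)
    qed
  next
    assume R: ?R
    show ?L
    proof safe
      fix i h k
      assume "i \<in> nodes I" and "(h, k) \<in> requests I"
      show "(\<Sum>j \<in> {j. (i, j) \<in> arcs I}. extend_f I Q f (i, j) (h, k))
          - (\<Sum>j' \<in> {j'. (j', i) \<in> arcs I}. extend_f I Q f (j', i) (h, k)) =
          (if i = h then request_ind Q (h, k) else if i = k then - request_ind Q (h, k) else 0)"
      proof (cases "(h, k) \<in> Q")
        case False
        then show ?thesis
          by (simp add: sum_extend_f_out sum_extend_f_in request_ind_def)
      next
        case hk: True
        show ?thesis
        proof (cases "i \<in> request_nodes Q")
          case True
          from R[rule_format, OF True hk] hk show ?thesis
            by (simp add: sum_extend_f_out sum_extend_f_in request_ind_def)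
        next
          case False
          with ends[OF hk] have "i \<noteq> h" "i \<noteq> k" by auto
          with hk show ?thesis
            by (simp add: sum_extend_f_out sum_extend_f_in no_arcs[OF False])
        qed
      qed
    qed
  qed
  have nonneg: "(\<forall>a \<in> arcs I. \<forall>q \<in> requests I. extend_f I Q f a q \<ge> 0) \<longleftrightarrow>
      (\<forall>a \<in> request_arcs I Q. \<forall>q \<in> Q. f a q \<ge> 0)"
    using Q_sub request_arcs_subset[of I Q] by (auto simp: extend_f_def)
  have swap: "{j, i} \<in> request_edges I Q \<longleftrightarrow> {i, j} \<in> request_edges I Q" for i j
    by (simp add: insert_commute)
  have coupling: "(\<forall>i j. {i, j} \<in> edges I \<longrightarrow> (\<forall>q \<in> requests I.
        extend_x I Q x {i, j} - extend_f I Q f (i, j) q \<ge> 0 \<and>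
        extend_x I Q x {i, j} - extend_f I Q f (j, i) q \<ge> 0)) \<and>
        (\<forall>e \<in> edges I. extend_x I Q x e \<in> {0, 1}) \<longleftrightarrow>
      (\<forall>i j. {i, j} \<in> request_edges I Q \<longrightarrow>
        (\<forall>q \<in> Q. x {i, j} - f (i, j) q \<ge> 0 \<and> x {i, j} - f (j, i) q \<ge> 0)) \<and>
        (\<forall>e \<in> request_edges I Q. x e \<in> {0, 1})"
    (is "?A \<and> ?B \<longleftrightarrow> ?C \<and> ?D")
  proof -
    have BD: "?B \<longleftrightarrow> ?D"
      using request_edges_subset[of I Q] by (auto simp: extend_x_def)
    have "?A \<Longrightarrow> ?C"
    proof (intro allI impI ballI)
      fix i j q
      assume A: ?A and e: "{i, j} \<in> request_edges I Q" and q: "q \<in> Q"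
      with Q_sub request_edges_subset[of I Q] have "{i, j} \<in> edges I" "q \<in> requests I"
        by auto
      with A have "extend_x I Q x {i, j} - extend_f I Q f (i, j) q \<ge> 0 \<and>
          extend_x I Q x {i, j} - extend_f I Q f (j, i) q \<ge> 0"
        by blast
      with e q show "x {i, j} - f (i, j) q \<ge> 0 \<and> x {i, j} - f (j, i) q \<ge> 0"
        by (simp add: extend_x_def extend_f_def pair_in_request_arcs_iff swap)
    qed
    moreover have "?C \<and> ?D \<Longrightarrow> ?A"
    proof (intro allI impI ballI)
      fix i j q
      assume CD: "?C \<and> ?D"
      show "extend_x I Q x {i, j} - extend_f I Q f (i, j) q \<ge> 0 \<and>
          extend_x I Q x {i, j} - extend_f I Q f (j, i) q \<ge> 0"
      proof (cases "{i, j} \<in> request_edges I Q")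
        case False
        then show ?thesis
          by (simp add: extend_x_def extend_f_def pair_in_request_arcs_iff swap)
      next
        case e: True
        with CD have "x {i, j} \<ge> 0" by fastforce
        moreover have "q \<in> Q \<Longrightarrow> x {i, j} - f (i, j) q \<ge> 0 \<and> x {i, j} - f (j, i) q \<ge> 0"
          using CD e by blast
        ultimately show ?thesis
          using e by (simp add: extend_x_def extend_f_def pair_in_request_arcs_iff swap)
      qed
    qed
    ultimately show ?thesis
      using BD by blast
  qed
  show ?thesis
    unfolding R_feasible_choose_cover_iff[OF Q compulsory] TSPGL_feasible_def degree balance nonneg
      coupling
    by blast
qed

text \<open>Restricting a feasible point of (R) to the variables of TSP-GL(\<open>Q\<close>) only discards values that
  are already zero and the flows of requests not in \<open>Q\<close>.\<close>

lemma R_feasible_extend: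
  assumes Q: "Q \<in> minimal_covers I" and compulsory: "compulsory I \<subseteq> request_nodes Q"
    and feas: "R_feasible I (choose_cover Q) x f"
  shows "R_feasible I (choose_cover Q) (extend_x I Q x) (extend_f I Q f)"
proof -
  note R = feas[unfolded R_feasible_choose_cover_iff[OF Q compulsory]]
  note off = R_feasible_off_cover[OF Q compulsory feas]
  have x_eq: "extend_x I Q x e = x e" if "e \<in> edges I" for e
    using off(1)[OF that] by (auto simp: extend_x_def)
  have f_eq: "extend_f I Q f a q = (if q \<in> Q then f a q else 0)"
    if "a \<in> arcs I" "q \<in> requests I" for a q
    using off(2)[OF that(1) _ that(2)] by (auto simp: extend_f_def)
  have degree: "(\<Sum>e \<in> {e \<in> edges I. i \<in> e}. extend_x I Q x e) = (\<Sum>e \<in> {e \<in> edges I. i \<in> e}. x e)"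
    for i
    by (intro sum.cong) (auto simp: x_eq)
  have out_flow: "(\<Sum>j \<in> {j. (i, j) \<in> arcs I}. extend_f I Q f (i, j) q) =
      (if q \<in> Q then \<Sum>j \<in> {j. (i, j) \<in> arcs I}. f (i, j) q else 0)"
    if "q \<in> requests I" for i q
    using that by (simp add: f_eq)
  have in_flow: "(\<Sum>j \<in> {j. (j, i) \<in> arcs I}. extend_f I Q f (j, i) q) =
      (if q \<in> Q then \<Sum>j \<in> {j. (j, i) \<in> arcs I}. f (j, i) q else 0)"
    if "q \<in> requests I" for i q
    using that by (simp add: f_eq)
  have balance: "(\<Sum>j \<in> {j. (i, j) \<in> arcs I}. extend_f I Q f (i, j) (h, k))
      - (\<Sum>j' \<in> {j'. (j', i) \<in> arcs I}. extend_f I Q f (j', i) (h, k)) =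
      (if i = h then request_ind Q (h, k) else if i = k then - request_ind Q (h, k) else 0)"
    if i: "i \<in> nodes I" and hk: "(h, k) \<in> requests I" for i h k
  proof (cases "(h, k) \<in> Q")
    case True
    have "(\<Sum>j \<in> {j. (i, j) \<in> arcs I}. f (i, j) (h, k))
        - (\<Sum>j' \<in> {j'. (j', i) \<in> arcs I}. f (j', i) (h, k)) =
        (if i = h then request_ind Q (h, k) else if i = k then - request_ind Q (h, k) else 0)"
      using R i hk by blast
    with True hk show ?thesis
      by (simp add: out_flow in_flow)
  next
    case False
    with hk show ?thesis
      by (simp add: out_flow in_flow request_ind_def)
  qed
  have x_nonneg: "x e \<ge> 0" if "e \<in> edges I" for e
    using R that by force
  have coupling: "extend_x I Q x {i, j} - extend_f I Q f (i, j) q \<ge> 0 \<and>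
      extend_x I Q x {i, j} - extend_f I Q f (j, i) q \<ge> 0"
    if e: "{i, j} \<in> edges I" and q: "q \<in> requests I" for i j q
  proof -
    have "(i, j) \<in> arcs I" "(j, i) \<in> arcs I"
      using e by (simp_all add: pair_in_arcs_iff insert_commute)
    moreover have "x {i, j} - f (i, j) q \<ge> 0 \<and> x {i, j} - f (j, i) q \<ge> 0"
      using R e q by blast
    ultimately show ?thesis
      using e q x_nonneg[OF e] by (simp add: x_eq f_eq)
  qed
  have "\<forall>a \<in> arcs I. \<forall>q \<in> requests I. extend_f I Q f a q \<ge> 0"
    using R by (simp add: f_eq)
  moreover have "\<forall>e \<in> edges I. extend_x I Q x e \<in> {0, 1}"
    using R by (simp add: x_eq)
  ultimately show ?thesis
    unfolding R_feasible_choose_cover_iff[OF Q compulsory] degree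
    using R balance coupling by blast
qed

lemma R_objective_extend_le:
  assumes inst: "stsp_gl_instance I"
    and Q: "Q \<in> minimal_covers I" and compulsory: "compulsory I \<subseteq> request_nodes Q"
    and feas: "R_feasible I (choose_cover Q) x f"
  shows "R_objective I (extend_x I Q x) (extend_f I Q f) \<le> R_objective I x f"
proof -
  have "(\<Sum>e \<in> edges I. design_cost I e * extend_x I Q x e) = (\<Sum>e \<in> edges I. design_cost I e * x e)"
    using R_feasible_off_cover(1)[OF Q compulsory feas]
    by (intro sum.cong) (auto simp: extend_x_def)
  moreover have "(\<Sum>a \<in> arcs I. \<Sum>q \<in> requests I. routing_cost I a q * extend_f I Q f a q) \<le>
      (\<Sum>a \<in> arcs I. \<Sum>q \<in> requests I. routing_cost I a q * f a q)"
  proof (intro sum_mono)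
    fix a q
    assume aq: "a \<in> arcs I" "q \<in> requests I"
    then have "f a q \<ge> 0"
      using feas by (simp add: R_feasible_def)
    then have "extend_f I Q f a q \<le> f a q"
      by (simp add: extend_f_def)
    then show "routing_cost I a q * extend_f I Q f a q \<le> routing_cost I a q * f a q"
      using routing_cost_nonneg[OF inst aq] by (rule mult_left_mono)
  qed
  moreover have "tradeoff I \<ge> 0"
    using inst by (simp add: stsp_gl_instance_def)
  ultimately show ?thesis
    by (simp add: R_objective_def mult_left_mono)
qed

section \<open>Decomposition and optimality\<close>

lemma R_decomposes_of_minimal_cover:
  assumes "stsp_gl_instance I" "Q \<in> minimal_covers I" "compulsory I \<subseteq> request_nodes Q"
  shows "R_decomposes I Q"
  unfolding R_decomposes_def
proof (intro conjI allI impI)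
  fix x f
  assume feas: "R_feasible I (choose_cover Q) x f"
  have "vanishes_outside I Q (extend_x I Q x) (extend_f I Q f)"
    by (auto simp: vanishes_outside_def extend_x_def extend_f_def)
  with R_feasible_extend[OF assms(2,3) feas] R_objective_extend_le[OF assms feas]
  show "\<exists>x' f'. R_feasible I (choose_cover Q) x' f' \<and> vanishes_outside I Q x' f' \<and>
      R_objective I x' f' \<le> R_objective I x f"
    by blast
qed (use assms in \<open>simp_all add: R_feasible_extend_iff R_objective_extend minimal_cover_subset_requests\<close>)

lemma R_feasible_obtains_cover:
  assumes feas: "R_feasible I chi x f"
  obtains Q where "Q \<in> minimal_covers I" "R_feasible I (choose_cover Q) x f"
proof -
  have total: "(\<Sum>Q \<in> minimal_covers I. chi Q) = 1"
    and binary: "\<forall>Q \<in> minimal_covers I. chi Q \<in> {0, 1}"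
    using feas by (simp_all add: R_feasible_def)
  obtain Q where Q: "Q \<in> minimal_covers I" and "chi Q \<noteq> 0"
    using total by (metis sum.neutral zero_neq_one)
  with binary have one: "chi Q = 1" by auto
  have "(\<Sum>Q' \<in> minimal_covers I - {Q}. chi Q') = 0"
    using total one sum.remove[OF finite_minimal_covers Q, of chi] by simp
  then have rest: "\<forall>Q' \<in> minimal_covers I - {Q}. chi Q' = 0"
    using binary finite_minimal_covers[of I]
    by (subst (asm) sum_nonneg_eq_0_iff) auto
  \<comment> \<open>Only the values of \<open>\<chi>\<close> on minimal covers enter the constraints.\<close>
  have eq: "chi Q' = choose_cover Q Q'" if "Q' \<in> minimal_covers I" for Q'
    using that one rest by (auto simp: choose_cover_def)
  have weighted: "(\<Sum>Q' \<in> minimal_covers I. chi Q' * g Q') =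
      (\<Sum>Q' \<in> minimal_covers I. choose_cover Q Q' * g Q')" for g :: "request set \<Rightarrow> real"
    by (intro sum.cong) (simp_all add: eq)
  have plain: "(\<Sum>Q' \<in> minimal_covers I. chi Q') = (\<Sum>Q' \<in> minimal_covers I. choose_cover Q Q')"
    by (intro sum.cong) (simp_all add: eq)
  have integral: "(\<forall>Q' \<in> minimal_covers I. chi Q' \<in> {0, 1}) \<longleftrightarrow>
      (\<forall>Q' \<in> minimal_covers I. choose_cover Q Q' \<in> {0, 1})"
    by (simp add: eq)
  have "R_feasible I (choose_cover Q) x f"
    using feas unfolding R_feasible_def weighted plain integral .
  with Q show thesis by (rule that)
qed

lemma obj_TSPGL_le:
  "TSPGL_feasible I Q x f \<Longrightarrow> obj_TSPGL I Q \<le> ereal (TSPGL_objective I Q x f)"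
  unfolding obj_TSPGL_def by (rule Inf_lower) blast

lemma obj_TSPGL_eq_optimal:
  assumes "TSPGL_optimal I Q x f"
  shows "obj_TSPGL I Q = ereal (TSPGL_objective I Q x f)"
proof (rule antisym)
  show "obj_TSPGL I Q \<le> ereal (TSPGL_objective I Q x f)"
    using assms by (simp add: TSPGL_optimal_def obj_TSPGL_le)
  show "ereal (TSPGL_objective I Q x f) \<le> obj_TSPGL I Q"
    unfolding obj_TSPGL_def
    using assms by (intro Inf_greatest) (auto simp: TSPGL_optimal_def)
qed

text \<open>The comparison of covers goes through the extended-real optimal values, so that a cover whose
  TSP-GL problem is infeasible has value \<open>\<infinity>\<close>; no feasible point of (R) selects such a cover.\<close>

lemma R_optimal_of_best_cover:
  assumes inst: "stsp_gl_instance I"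
    and compulsory: "\<And>Q. Q \<in> minimal_covers I \<Longrightarrow> compulsory I \<subseteq> request_nodes Q"
    and best: "is_arg_min (obj_TSPGL I) (\<lambda>Q. Q \<in> minimal_covers I) Qs"
    and opt: "TSPGL_optimal I Qs x f"
  shows "R_optimal I (choose_cover Qs) (extend_x I Qs x) (extend_f I Qs f)"
  unfolding R_optimal_def
proof (intro conjI allI impI)
  have Qs: "Qs \<in> minimal_covers I"
    using best by (simp add: is_arg_min_def)
  show "R_feasible I (choose_cover Qs) (extend_x I Qs x) (extend_f I Qs f)"
    using opt R_feasible_extend_iff[OF Qs compulsory[OF Qs]] by (simp add: TSPGL_optimal_def)
  fix chi' x' f'
  assume "R_feasible I chi' x' f'"
  then obtain Q where Q: "Q \<in> minimal_covers I" and feas: "R_feasible I (choose_cover Q) x' f'"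
    by (rule R_feasible_obtains_cover)
  have "TSPGL_feasible I Q x' f'"
    using R_feasible_extend[OF Q compulsory[OF Q] feas] R_feasible_extend_iff[OF Q compulsory[OF Q]]
    by simp
  have "ereal (TSPGL_objective I Qs x f) = obj_TSPGL I Qs"
    using obj_TSPGL_eq_optimal[OF opt] by simp
  also have "\<dots> \<le> obj_TSPGL I Q"
    using best Q by (auto simp: is_arg_min_def not_less)
  also have "\<dots> \<le> ereal (TSPGL_objective I Q x' f')"
    by (rule obj_TSPGL_le) fact
  also have "\<dots> = ereal (R_objective I (extend_x I Q x') (extend_f I Q f'))"
    by (simp add: R_objective_extend minimal_cover_subset_requests[OF Q])
  also have "\<dots> \<le> ereal (R_objective I x' f')"
    using R_objective_extend_le[OF inst Q compulsory[OF Q] feas] by simp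
  finally show "R_objective I (extend_x I Qs x) (extend_f I Qs f) \<le> R_objective I x' f'"
    by (simp add: R_objective_extend minimal_cover_subset_requests[OF Qs])
qed

theorem theorem2p3:
  fixes I :: "('w, 's) stsp_gl"
  assumes "stsp_gl_instance I"
    and "triangle_inequality I"
  shows "(\<forall>Q' \<in> minimal_covers I. compulsory I \<subseteq> request_nodes Q' \<longrightarrow> R_decomposes I Q') \<and>
    ((\<forall>Q \<in> minimal_covers I. compulsory I \<subseteq> request_nodes Q) \<longrightarrow>
      (\<forall>Qs x f. is_arg_min (obj_TSPGL I) (\<lambda>Q. Q \<in> minimal_covers I) Qs \<and> TSPGL_optimal I Qs x f \<longrightarrow>
        R_optimal I (choose_cover Qs) (extend_x I Qs x) (extend_f I Qs f)))"
  using R_decomposes_of_minimal_cover[OF assms(1)] R_optimal_of_best_cover[OF assms(1)] by blast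

end
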